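(* Let $X$ be a standard Borel space, and let $f:X\to X$ be an acyclic Borel function. Then the following are equivalent: (i) $\operatorname{asdim}_B(\mathcal{G}_f)$ is finite. (ii) $\operatorname{asdim}_B(\mathcal{G}_f)=1$. (iii) For each $r\in\mathbb{N}^+$, there is a Borel $r$-forward-independent hitting set for $f$.
   Context: Write $\mathbb{N}^+=\mathbb{N}\setminus\{0\}$. A function $f:X\to X$ is acyclic if $f^k(x)\neq x$ for every $x\in X$ and $k\in\mathbb{N}^+$. (No assumption is made on the size of the fibers of $f$.) $\mathcal{G}_f$ is the undirected graph on $X$ in which $x,y$ are adjacent if and only if $x\neq y$ and either $f(x)=y$ or $f(y)=x$. Let $\rho_f$ be its graph distance (with value $\infty$ between different connected components). A set $H\subseteq X$ is hitting for $f$ if for each $x\in X$ there is $k\in\mathbb{N}^+$ with $f^k(x)\in H$. For $r\in\mathbb{N}^+$, $H$ is $r$-forward-independent for $f$ if, for any $x\in H$ and $k\in\mathbb{N}^+$, $f^k(x)\in H$ implies $k>r$. For $U\subseteq X$ and $r\in\mathbb{N}^+$, $\mathcal{F}_r(U)$ is the equivalence relation on $U$ generated by the pairs $(x,y)\in U^2$ with $\rho_f(x,y)\le r$. An equivalence relation is uniformly $\rho_f$-bounded if there is $M>0$ such that each of its classes has $\rho_f$-diameter at most $M$. The Borel asymptotic dimension $\operatorname{asdim}_B(\mathcal{G}_f)$ is the least $d\in\mathbb{N}$ such that for every $r\in\mathbb{N}^+$ there are Borel sets $U_0,\dots,U_d$ covering $X$ such that $\mathcal{F}_r(U_i)$ is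 uniformly $\rho_f$-bounded for every $i\le d$; it is infinite if there is no such $d$.
   Formalization: X is assumed nonempty: for empty X the Borel asymptotic dimension is 0, so (i) and (iii) hold while (ii) fails. *)

theory Defs
  imports "HOL-Analysis.Analysis"
begin

text \<open>As usual, a measurable space is rendered by a value \<open>M\<close> of type \<open>measure\<close>, of which only \<open>space M\<close> and
  \<open>sets M\<close> matter.\<close>

definition standard_Borel :: "'a measure \<Rightarrow> bool" where
  "standard_Borel M \<longleftrightarrow>
     (\<exists>T. separable_space T \<and> completely_metrizable_space T \<and>
          topspace T = space M \<and> sets M = sigma_sets (topspace T) {U. openin T U})"

definition acyclic_function_on :: "'a set \<Rightarrow> ('a \<Rightarrow> 'a) \<Rightarrow> bool" where
  "acyclic_function_on X f \<longleftrightarrow> (\<forall>x\<in>X. \<forall>k::nat. k > 0 \<longrightarrow> (f ^^ k) x \<noteq> x)"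

definition hitting_set :: "'a set \<Rightarrow> ('a \<Rightarrow> 'a) \<Rightarrow> 'a set \<Rightarrow> bool" where
  "hitting_set X f H \<longleftrightarrow> H \<subseteq> X \<and> (\<forall>x\<in>X. \<exists>k::nat. k > 0 \<and> (f ^^ k) x \<in> H)"

definition forward_independent :: "nat \<Rightarrow> ('a \<Rightarrow> 'a) \<Rightarrow> 'a set \<Rightarrow> bool" where
  "forward_independent r f H \<longleftrightarrow> (\<forall>x\<in>H. \<forall>k::nat. k > 0 \<longrightarrow> (f ^^ k) x \<in> H \<longrightarrow> k > r)"

text \<open>An undirected graph is given by its symmetric, irreflexive adjacency relation.\<close>

definition function_graph :: "'a set \<Rightarrow> ('a \<Rightarrow> 'a) \<Rightarrow> ('a \<times> 'a) set" where
  "function_graph X f = {(x, y). x \<in> X \<and> y \<in> X \<and> x \<noteq> y \<and> (f x = y \<or> f y = x)}"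

text \<open>\<open>(x, y) \<in> G ^^ n\<close> says that there is a walk of length \<open>n\<close> from \<open>x\<close> to \<open>y\<close>. The infimum of the
  empty set is \<open>\<infinity>\<close>.\<close>

definition graph_dist :: "('a \<times> 'a) set \<Rightarrow> 'a \<Rightarrow> 'a \<Rightarrow> enat" where
  "graph_dist G x y = Inf {enat n | n. (x, y) \<in> G ^^ n}"

definition generated_equiv :: "'a set \<Rightarrow> ('a \<times> 'a) set \<Rightarrow> ('a \<times> 'a) set" where
  "generated_equiv U R = \<Inter>{E. equiv U E \<and> R \<subseteq> E}"

definition proximity_equiv :: "('a \<Rightarrow> 'a \<Rightarrow> enat) \<Rightarrow> nat \<Rightarrow> 'a set \<Rightarrow> ('a \<times> 'a) set" where
  "proximity_equiv \<rho> r U = generated_equiv U {(x, y). x \<in> U \<and> y \<in> U \<and> \<rho> x y \<le> enat r}"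

definition dist_diameter :: "('a \<Rightarrow> 'a \<Rightarrow> enat) \<Rightarrow> 'a set \<Rightarrow> enat" where
  "dist_diameter \<rho> C = (SUP x\<in>C. SUP y\<in>C. \<rho> x y)"

text \<open>Distances are extended natural numbers, so the bound may be taken to be a natural number.\<close>

definition uniformly_bounded_equiv :: "('a \<Rightarrow> 'a \<Rightarrow> enat) \<Rightarrow> 'a set \<Rightarrow> ('a \<times> 'a) set \<Rightarrow> bool" where
  "uniformly_bounded_equiv \<rho> U E \<longleftrightarrow>
     (\<exists>m::nat. m > 0 \<and> (\<forall>C \<in> U // E. dist_diameter \<rho> C \<le> enat m))"

definition Borel_asdim_le :: "'a measure \<Rightarrow> ('a \<times> 'a) set \<Rightarrow> nat \<Rightarrow> bool" where
  "Borel_asdim_le M G d \<longleftrightarrow>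
     (\<forall>r::nat. r > 0 \<longrightarrow>
        (\<exists>U :: nat \<Rightarrow> 'a set.
           (\<forall>i\<le>d. U i \<in> sets M) \<and> (\<Union>i\<le>d. U i) = space M \<and>
           (\<forall>i\<le>d. uniformly_bounded_equiv (graph_dist G) (U i)
                     (proximity_equiv (graph_dist G) r (U i)))))"

definition Borel_asdim :: "'a measure \<Rightarrow> ('a \<times> 'a) set \<Rightarrow> enat" where
  "Borel_asdim M G =
     (if \<exists>d. Borel_asdim_le M G d then enat (LEAST d. Borel_asdim_le M G d) else \<infinity>)"

end

theory Submission
  imports Defs
begin

text \<open>
  Everything rests on the shape of \<open>\<G>\<^sub>f\<close>: two points are at distance at most \<open>n\<close> exactly when their forward
  orbits merge after \<open>a\<close> and \<open>b\<close> steps with \<open>a + b \<le> n\<close>. In particular \<open>x\<close> and \<open>f\<^sup>k x\<close> are at distance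
  exactly \<open>k\<close>, by acyclicity.

  \<^emph>\<open>From finite dimension to forward-independent hitting sets.\<close> Let \<open>U\<^sub>0, \<dots>, U\<^sub>d\<close> be a cover for the scale \<open>r\<close>.
  Call a point of \<open>U\<^sub>i\<close> terminal if none of its next \<open>r\<close> iterates lies in \<open>U\<^sub>i\<close>. The terminal points of \<open>U\<^sub>i\<close>
  form an \<open>r\<close>-forward-independent set by definition. An orbit starting in \<open>U\<^sub>i\<close> reaches a terminal point:
  otherwise it would return to \<open>U\<^sub>i\<close> forever in jumps of length at most \<open>r\<close>, so that a single class of
  \<open>\<F>\<^sub>r(U\<^sub>i)\<close> would contain points of the orbit that are arbitrarily far apart
  (\<open>reaches_terminal_points\<close>). Each orbit is always in one of finitely many \<open>U\<^sub>i\<close>, so it meets the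
  terminal points of some \<open>U\<^sub>i\<close> infinitely often. The least such \<open>i\<close> is an \<open>f\<close>-invariant function of the
  starting point, hence no interaction between different \<open>i\<close> has to be controlled: on each level set of this
  function the terminal points of the corresponding \<open>U\<^sub>i\<close> are taken
  (\<open>finite_asdim_imp_forward_independent_hitting_set\<close>). The first half of the argument also
  excludes dimension \<open>0\<close>, because no point of the whole space is terminal.

  \<^emph>\<open>From forward-independent hitting sets to dimension at most one.\<close> Suppose that every orbit meets a set
  \<open>A\<close> within a bounded number of steps. Far below \<open>A\<close>, the graph decomposes into bounded pieces, each consisting
  of the points with the same first point in \<open>A\<close>: when two points that need at least \<open>r\<close> steps to reach \<open>A\<close>
  are at distance at most \<open>r\<close>, their orbits merge before either passes \<open>A\<close>
  (\<open>bounded_below_syndetic_set\<close>). So it suffices to find two such Borel sets such that no orbit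
  meets both within its first \<open>r\<close> points. Given a \<open>2r\<close>-forward-independent hitting set \<open>H\<close>, these are obtained
  by looking at the number of steps to \<open>H\<close> modulo \<open>2r\<close>: one takes the residues \<open>0\<close> and \<open>r\<close>. The only conflict
  arises at the points of \<open>H\<close> itself, where the counting restarts, and is resolved by
  dropping those points of \<open>H\<close> that the residue class \<open>r\<close> follows too closely.
\<close>

section \<open>Distances in the graph of an acyclic function\<close>

locale acyclic_Borel_map =
  fixes M :: "'a measure" and f :: "'a \<Rightarrow> 'a"
  assumes measurable_map [measurable]: "f \<in> M \<rightarrow>\<^sub>M M"
    and acyclic: "acyclic_function_on (space M) f"
begin

abbreviation G :: "('a \<times> 'a) set" where
  "G \<equiv> function_graph (space M) f"

abbreviation \<rho> :: "'a \<Rightarrow> 'a \<Rightarrow> enat" where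
  "\<rho> \<equiv> graph_dist G"

lemma funpow_closed: "x \<in> space M \<Longrightarrow> (f ^^ k) x \<in> space M"
  using measurable_space[OF measurable_compose_n[OF measurable_map]] .

lemma map_closed: "x \<in> space M \<Longrightarrow> f x \<in> space M"
  using funpow_closed[of x 1] by simp

lemma funpow_inject:
  assumes x: "x \<in> space M" and eq: "(f ^^ j) x = (f ^^ k) x"
  shows "j = k"
proof -
  have no_return: "(f ^^ (a + Suc b)) x \<noteq> (f ^^ a) x" for a b
  proof -
    have "(f ^^ Suc b) ((f ^^ a) x) \<noteq> (f ^^ a) x"
      using acyclic funpow_closed[OF x] unfolding acyclic_function_on_def by blast
    then show ?thesis
      by (metis add.commute comp_apply funpow_add)
  qed
  show ?thesis
    using no_return eq by (metis less_imp_Suc_add add_Suc_right nat_neq_iff)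
qed

lemma walk_forward: "x \<in> space M \<Longrightarrow> (x, (f ^^ k) x) \<in> G ^^ k"
proof (induction k)
  case (Suc k)
  have "((f ^^ k) x, (f ^^ Suc k) x) \<in> G"
    using funpow_closed[OF Suc.prems] map_closed funpow_inject[OF Suc.prems, of k "Suc k"]
    by (auto simp: function_graph_def)
  with Suc show ?case by auto
qed auto

lemma walk_sym: "(x, y) \<in> G ^^ n \<Longrightarrow> (y, x) \<in> G ^^ n"
proof (induction n arbitrary: y)
  case (Suc n)
  then obtain z where z: "(x, z) \<in> G ^^ n" "(z, y) \<in> G"
    by auto
  have "(y, z) \<in> G"
    using z(2) by (auto simp: function_graph_def)
  moreover note Suc.IH[OF z(1)]
  ultimately show ?case
    by (rule relpow_Suc_I2)
qed auto

lemma walk_imp_orbits_merge: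
  "(x, y) \<in> G ^^ n \<Longrightarrow> \<exists>a b. a + b \<le> n \<and> (f ^^ a) x = (f ^^ b) y"
proof (induction n arbitrary: y)
  case 0
  then show ?case by auto
next
  case (Suc n)
  then obtain z where z: "(x, z) \<in> G ^^ n" "(z, y) \<in> G"
    by auto
  obtain a b where ab: "a + b \<le> n" "(f ^^ a) x = (f ^^ b) z"
    using Suc.IH[OF z(1)] by blast
  consider (up) "f z = y" | (down) "f y = z"
    using z(2) by (auto simp: function_graph_def)
  then show ?case
  proof cases
    case up
    show ?thesis
    proof (cases b)
      case 0
      then have "(f ^^ Suc a) x = (f ^^ 0) y" "Suc a + 0 \<le> Suc n"
        using ab up by auto
      then show ?thesis by blast
    next
      case (Suc c)
      then have "(f ^^ a) x = (f ^^ c) y" "a + c \<le> Suc n"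
        using ab up by (auto simp: funpow_swap1)
      then show ?thesis by blast
    qed
  next
    case down
    then have "(f ^^ a) x = (f ^^ Suc b) y" "a + Suc b \<le> Suc n"
      using ab by (auto simp: funpow_swap1)
    then show ?thesis by blast
  qed
qed

lemma dist_le_imp_orbits_merge:
  assumes "\<rho> x y \<le> enat r"
  shows "\<exists>a b. a + b \<le> r \<and> (f ^^ a) x = (f ^^ b) y"
proof -
  let ?S = "{enat n | n. (x, y) \<in> G ^^ n}"
  have nonempty: "?S \<noteq> {}"
  proof
    assume "?S = {}"
    then have "\<rho> x y = \<infinity>"
      unfolding graph_dist_def by (simp only: Inf_empty top_enat_def)
    with assms show False by simp
  qed
  then have "\<rho> x y = (LEAST v. v \<in> ?S)"
    unfolding graph_dist_def Inf_enat_def by (simp only: if_False)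
  moreover obtain v where "v \<in> ?S"
    using nonempty by blast
  ultimately have "\<rho> x y \<in> ?S"
    by (metis (mono_tags, lifting) LeastI)
  then obtain n where "\<rho> x y = enat n" "(x, y) \<in> G ^^ n"
    by blast
  with assms walk_imp_orbits_merge[of x y n] show ?thesis
    by (metis enat_ord_simps(1) le_trans)
qed

lemma dist_le_if_orbits_merge:
  assumes "x \<in> space M" "y \<in> space M" "(f ^^ a) x = (f ^^ b) y"
  shows "\<rho> x y \<le> enat (a + b)"
proof -
  have "((f ^^ b) y, y) \<in> G ^^ b"
    using walk_sym[OF walk_forward] assms by blast
  then have "(x, y) \<in> G ^^ (a + b)"
    using walk_forward[of x a] assms unfolding relpow_add by auto
  then show ?thesis
    unfolding graph_dist_def by (intro Inf_lower) blast
qed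

lemma dist_forward_le: "x \<in> space M \<Longrightarrow> \<rho> x ((f ^^ k) x) \<le> enat k"
  using dist_le_if_orbits_merge[of x "(f ^^ k) x" k 0] funpow_closed by simp

lemma dist_forward_ge:
  assumes x: "x \<in> space M" and le: "\<rho> x ((f ^^ k) x) \<le> enat r"
  shows "k \<le> r"
proof -
  obtain a b where ab: "a + b \<le> r" "(f ^^ a) x = (f ^^ b) ((f ^^ k) x)"
    using dist_le_imp_orbits_merge[OF le] by blast
  then have "(f ^^ a) x = (f ^^ (b + k)) x"
    by (simp add: funpow_add)
  then have "a = b + k"
    by (rule funpow_inject[OF x])
  with ab(1) show ?thesis by linarith
qed

section \<open>Classes of the proximity relation\<close>

lemma proximity_equiv_step:
  assumes "x \<in> U" "y \<in> U" "\<rho> x y \<le> enat r"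
  shows "(x, y) \<in> proximity_equiv \<rho> r U"
  using assms by (auto simp: proximity_equiv_def generated_equiv_def)

lemma proximity_equiv_refl: "x \<in> U \<Longrightarrow> (x, x) \<in> proximity_equiv \<rho> r U"
  by (auto simp: proximity_equiv_def generated_equiv_def equiv_def refl_on_def)

lemma proximity_equiv_trans:
  assumes "(x, y) \<in> proximity_equiv \<rho> r U" "(y, z) \<in> proximity_equiv \<rho> r U"
  shows "(x, z) \<in> proximity_equiv \<rho> r U"
  using assms unfolding proximity_equiv_def generated_equiv_def equiv_def
  by (blast dest: transD)

lemma uniformly_bounded_equivD:
  assumes "uniformly_bounded_equiv \<rho> U (proximity_equiv \<rho> r U)"
  obtains m where "\<And>x y. x \<in> U \<Longrightarrow> (x, y) \<in> proximity_equiv \<rho> r U \<Longrightarrow> \<rho> x y \<le> enat m"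
proof -
  let ?E = "proximity_equiv \<rho> r U"
  obtain m where m: "\<And>C. C \<in> U // ?E \<Longrightarrow> dist_diameter \<rho> C \<le> enat m"
    using assms unfolding uniformly_bounded_equiv_def by blast
  have "\<rho> x y \<le> enat m" if "x \<in> U" "(x, y) \<in> ?E" for x y
  proof -
    have "\<rho> x y \<le> (SUP v\<in>?E `` {x}. \<rho> x v)"
      using that by (intro SUP_upper) auto
    also have "\<dots> \<le> dist_diameter \<rho> (?E `` {x})"
      unfolding dist_diameter_def using proximity_equiv_refl[OF that(1)]
      by (intro SUP_upper) auto
    also have "\<dots> \<le> enat m"
      using that by (intro m quotientI)
    finally show ?thesis .
  qed
  then show thesis using that by blast
qed

text \<open>
  Boundedness is proved by attaching to each point of \<open>U\<close> an anchor a bounded number of steps up its orbit.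
  If the anchor does not change along steps of size \<open>r\<close>, then it is constant on classes, and two
  points with the same anchor are close.
\<close>

lemma uniformly_bounded_if_anchored:
  assumes U: "U \<subseteq> space M"
    and anchor: "\<And>x. x \<in> U \<Longrightarrow> \<exists>k\<le>K. c x = (f ^^ k) x"
    and const: "\<And>x y. x \<in> U \<Longrightarrow> y \<in> U \<Longrightarrow> \<rho> x y \<le> enat r \<Longrightarrow> c x = c y"
  shows "uniformly_bounded_equiv \<rho> U (proximity_equiv \<rho> r U)"
  unfolding uniformly_bounded_equiv_def
proof (intro exI[of _ "Suc (2 * K)"] conjI ballI)
  let ?E = "proximity_equiv \<rho> r U" and ?F = "{(x, y). x \<in> U \<and> y \<in> U \<and> c x = c y}"
  have "equiv U ?F"
    by (rule equivI) (auto simp: refl_on_def sym_def trans_def)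
  then have EF: "?E \<subseteq> ?F"
    unfolding proximity_equiv_def generated_equiv_def using const
    by (intro Inter_lower) auto
  fix C assume "C \<in> U // ?E"
  then obtain z where z: "C = ?E `` {z}"
    by (auto elim: quotientE)
  have "\<rho> x y \<le> enat (Suc (2 * K))" if "x \<in> C" "y \<in> C" for x y
  proof -
    have xy: "x \<in> U" "y \<in> U" "c x = c y"
      using that subsetD[OF EF, of "(z, x)"] subsetD[OF EF, of "(z, y)"] z by auto
    obtain a b where ab: "a \<le> K" "b \<le> K" "(f ^^ a) x = (f ^^ b) y"
      using anchor[of x] anchor[of y] xy by metis
    have "\<rho> x y \<le> enat (a + b)"
      using dist_le_if_orbits_merge[of x y a b] xy U ab by blast
    also have "\<dots> \<le> enat (Suc (2 * K))"
      using ab by simp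
    finally show ?thesis .
  qed
  then show "dist_diameter \<rho> C \<le> enat (Suc (2 * K))"
    unfolding dist_diameter_def by (intro SUP_least)
qed simp

section \<open>From finite dimension to forward-independent hitting sets\<close>

definition terminal_points :: "nat \<Rightarrow> 'a set \<Rightarrow> 'a set" where
  "terminal_points r U = {x \<in> U. \<forall>k\<in>{1..r}. (f ^^ k) x \<notin> U}"

lemma measurable_terminal_points [measurable]:
  assumes [measurable]: "U \<in> sets M"
  shows "terminal_points r U \<in> sets M"
proof -
  have "terminal_points r U = {x \<in> space M. x \<in> U \<and> (\<forall>k\<in>{1..r}. (f ^^ k) x \<notin> U)}"
    using sets.sets_into_space[OF assms] by (auto simp: terminal_points_def)
  also have "\<dots> \<in> sets M" by measurable
  finally show ?thesis .
qed

text \<open>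
  An orbit without terminal points returns to \<open>U\<close> forever in jumps of length at most \<open>r\<close>, and the
  points of return are all in one class. A point \<open>f\<^sup>j x\<close> in the class of \<open>x\<close> satisfies \<open>j \<le> m\<close>, where \<open>m\<close> bounds the diameters.
\<close>

lemma reaches_terminal_points:
  assumes U: "U \<subseteq> space M"
    and bounded: "uniformly_bounded_equiv \<rho> U (proximity_equiv \<rho> r U)"
    and x: "x \<in> U"
  shows "\<exists>k. (f ^^ k) x \<in> terminal_points r U"
proof (rule ccontr)
  assume never: "\<nexists>k. (f ^^ k) x \<in> terminal_points r U"
  let ?E = "proximity_equiv \<rho> r U"
  have "\<exists>j\<ge>N. (x, (f ^^ j) x) \<in> ?E \<and> (f ^^ j) x \<in> U" for N
  proof (induction N)
    case 0
    show ?case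
      using x proximity_equiv_refl[OF x, of r] by (intro exI[of _ 0]) auto
  next
    case (Suc N)
    then obtain j where j: "N \<le> j" "(x, (f ^^ j) x) \<in> ?E" "(f ^^ j) x \<in> U"
      by blast
    then obtain k where k: "1 \<le> k" "k \<le> r" "(f ^^ k) ((f ^^ j) x) \<in> U"
      using never unfolding terminal_points_def by fastforce
    have "\<rho> ((f ^^ j) x) ((f ^^ k) ((f ^^ j) x)) \<le> enat r"
      using dist_forward_le[of "(f ^^ j) x" k] j(3) U k(2) by (meson enat_ord_simps(1) order_trans subsetD)
    then have "(x, (f ^^ k) ((f ^^ j) x)) \<in> ?E"
      using proximity_equiv_trans[OF j(2)] proximity_equiv_step[OF j(3) k(3)] by blast
    moreover have "(f ^^ k) ((f ^^ j) x) = (f ^^ (k + j)) x"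
      by (simp add: funpow_add)
    ultimately show ?case
      using k j(1) by (intro exI[of _ "k + j"]) auto
  qed
  moreover obtain m where "\<And>y. (x, y) \<in> ?E \<Longrightarrow> \<rho> x y \<le> enat m"
    using uniformly_bounded_equivD[OF bounded] x by metis
  ultimately obtain j where "Suc m \<le> j" "\<rho> x ((f ^^ j) x) \<le> enat m"
    by blast
  then show False
    using dist_forward_ge[of x j m] x U by auto
qed

lemma not_asdim_le_0:
  assumes "space M \<noteq> {}"
  shows "\<not> Borel_asdim_le M G 0"
proof
  assume "Borel_asdim_le M G 0"
  then have "uniformly_bounded_equiv \<rho> (space M) (proximity_equiv \<rho> 1 (space M))"
    unfolding Borel_asdim_le_def by (force dest: spec[of _ "1::nat"])
  moreover obtain x where "x \<in> space M"
    using assms by blast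
  ultimately obtain k where "(f ^^ k) x \<in> terminal_points 1 (space M)"
    using reaches_terminal_points by blast
  then show False
    using map_closed by (auto simp: terminal_points_def)
qed

lemma frequently_orbit_shift:
  "(\<exists>\<^sub>\<infinity>k. (f ^^ k) ((f ^^ j) x) \<in> A) \<longleftrightarrow> (\<exists>\<^sub>\<infinity>k. (f ^^ k) x \<in> A)"
proof -
  have "(\<exists>\<^sub>\<infinity>k. (f ^^ (k + j)) x \<in> A) \<longleftrightarrow> (\<exists>\<^sub>\<infinity>k. (f ^^ k) x \<in> A)"
    unfolding frequently_def cofinite_eq_sequentially
    using eventually_sequentially_seg[of "\<lambda>k. (f ^^ k) x \<notin> A" j] by simp
  then show ?thesis
    by (simp add: funpow_add)
qed

lemma finite_asdim_imp_forward_independent_hitting_set: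
  assumes dim: "Borel_asdim_le M G d" and r: "r > 0"
  shows "\<exists>H\<in>sets M. forward_independent r f H \<and> hitting_set (space M) f H"
proof -
  obtain U where U [measurable]: "\<And>i. i \<le> d \<Longrightarrow> U i \<in> sets M"
    and cover: "(\<Union>i\<le>d. U i) = space M"
    and bounded: "\<And>i. i \<le> d \<Longrightarrow> uniformly_bounded_equiv \<rho> (U i) (proximity_equiv \<rho> r (U i))"
    using dim r unfolding Borel_asdim_le_def by metis
  define T where "T i = (if i \<le> d then terminal_points r (U i) else {})" for i
  have T [measurable]: "T i \<in> sets M" for i
    unfolding T_def using U measurable_terminal_points by auto
  define index where "index x = (LEAST i. \<exists>\<^sub>\<infinity>k. (f ^^ k) x \<in> T i)" for x
  have index_measurable [measurable]: "index \<in> M \<rightarrow>\<^sub>M count_space UNIV"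
    unfolding index_def[abs_def] INFM_nat by measurable
  have index_invariant: "index ((f ^^ j) x) = index x" for j x
    unfolding index_def frequently_orbit_shift ..
  have index_frequently: "\<exists>\<^sub>\<infinity>k. (f ^^ k) x \<in> T (index x)" if x: "x \<in> space M" for x
  proof -
    have "\<exists>k>N. \<exists>i\<in>{..d}. (f ^^ k) x \<in> T i" for N
    proof -
      obtain i where i: "i \<le> d" "(f ^^ Suc N) x \<in> U i"
        using funpow_closed[OF x, of "Suc N"] cover by blast
      then obtain k where "(f ^^ k) ((f ^^ Suc N) x) \<in> T i"
        using reaches_terminal_points[OF sets.sets_into_space[OF U] bounded] by (metis T_def)
      then have "(f ^^ (k + Suc N)) x \<in> T i"
        by (metis comp_apply funpow_add)
      with i show ?thesis
        by (intro exI[of _ "k + Suc N"]) auto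
    qed
    then have "\<exists>i\<in>{..d}. \<exists>\<^sub>\<infinity>k. (f ^^ k) x \<in> T i"
      by (intro frequently_bex_finite) (auto simp: INFM_nat)
    then obtain i where "\<exists>\<^sub>\<infinity>k. (f ^^ k) x \<in> T i"
      by blast
    then show ?thesis
      unfolding index_def by (rule LeastI[where P = "\<lambda>i. \<exists>\<^sub>\<infinity>k. (f ^^ k) x \<in> T i"])
  qed
  define H where "H = {x \<in> space M. x \<in> T (index x)}"
  have "{x \<in> space M. \<exists>i. index x = i \<and> x \<in> T i} \<in> sets M"
    by measurable
  then have "H \<in> sets M"
    unfolding H_def by simp
  moreover have "forward_independent r f H"
    unfolding forward_independent_def
  proof (intro ballI allI impI)
    fix x k assume "x \<in> H" "0 < k" "(f ^^ k) x \<in> H"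
    then have "x \<in> T (index x)" "(f ^^ k) x \<in> T (index x)"
      by (auto simp: H_def index_invariant)
    then show "r < k"
      using \<open>0 < k\<close> by (force simp: T_def terminal_points_def split: if_splits)
  qed
  moreover have "hitting_set (space M) f H"
    unfolding hitting_set_def
  proof (intro conjI ballI)
    fix x assume x: "x \<in> space M"
    obtain k where "k > 0" "(f ^^ k) x \<in> T (index x)"
      using index_frequently[OF x] by (auto simp: INFM_nat)
    then show "\<exists>k>0. (f ^^ k) x \<in> H"
      using funpow_closed[OF x] by (auto simp: H_def index_invariant)
  qed (auto simp: H_def)
  ultimately show ?thesis by blast
qed

section \<open>From forward-independent hitting sets to dimension at most one\<close>

definition first_hit :: "'a set \<Rightarrow> 'a \<Rightarrow> nat" where
  "first_hit A x = (LEAST k. (f ^^ k) x \<in> A)"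

lemma measurable_first_hit [measurable]:
  assumes [measurable]: "A \<in> sets M"
  shows "first_hit A \<in> M \<rightarrow>\<^sub>M count_space UNIV"
  unfolding first_hit_def[abs_def] by measurable

lemma first_hit_le: "(f ^^ k) x \<in> A \<Longrightarrow> first_hit A x \<le> k"
  unfolding first_hit_def by (rule Least_le)

lemma first_hit_in: "(f ^^ k) x \<in> A \<Longrightarrow> (f ^^ first_hit A x) x \<in> A"
  unfolding first_hit_def by (rule LeastI)

lemma first_hit_funpow:
  assumes hit: "(f ^^ k) x \<in> A" and a: "a \<le> first_hit A x"
  shows "first_hit A ((f ^^ a) x) = first_hit A x - a"
  unfolding first_hit_def[of A "(f ^^ a) x"]
proof (rule Least_equality)
  show "(f ^^ (first_hit A x - a)) ((f ^^ a) x) \<in> A"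
    using first_hit_in[OF hit] a by (metis comp_apply funpow_add le_add_diff_inverse2)
next
  fix j assume "(f ^^ j) ((f ^^ a) x) \<in> A"
  then have "(f ^^ (j + a)) x \<in> A"
    by (simp add: funpow_add)
  then show "first_hit A x - a \<le> j"
    using first_hit_le by fastforce
qed

text \<open>
  The anchor is the first point of \<open>A\<close> on the orbit. Two points at distance at most \<open>r\<close> have orbits that merge
  within \<open>r\<close> steps. If neither orbit meets \<open>A\<close> before time \<open>r\<close>, no anchor is passed on the way to the merging
  point, so both points have the anchor of the merging point.
\<close>

lemma bounded_below_syndetic_set:
  assumes hit: "\<And>x. x \<in> space M \<Longrightarrow> \<exists>k\<le>K. (f ^^ k) x \<in> A"
    and V: "V = {x \<in> space M. \<forall>k<r. (f ^^ k) x \<notin> A}"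
  shows "uniformly_bounded_equiv \<rho> V (proximity_equiv \<rho> r V)"
proof (rule uniformly_bounded_if_anchored)
  let ?c = "\<lambda>x. (f ^^ first_hit A x) x"
  have anchor_merge: "?c ((f ^^ a) x) = ?c x" if x: "x \<in> V" and a: "a \<le> r" for x a
  proof -
    obtain k where k: "(f ^^ k) x \<in> A"
      using hit x V by blast
    then have "(f ^^ first_hit A x) x \<in> A"
      by (rule first_hit_in)
    then have "a \<le> first_hit A x"
      using x a V by (metis (mono_tags, lifting) linorder_not_le mem_Collect_eq order_trans)
    then show ?thesis
      using first_hit_funpow[OF k] by (metis comp_apply funpow_add le_add_diff_inverse2)
  qed
  show "V \<subseteq> space M"
    using V by blast
  show "\<exists>k\<le>K. ?c x = (f ^^ k) x" if "x \<in> V" for x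
    using hit[of x] that V first_hit_le order_trans by blast
  show "?c x = ?c y" if xy: "x \<in> V" "y \<in> V" and d: "\<rho> x y \<le> enat r" for x y
  proof -
    obtain a b where "a + b \<le> r" "(f ^^ a) x = (f ^^ b) y"
      using dist_le_imp_orbits_merge[OF d] by blast
    then show ?thesis
      using anchor_merge[OF xy(1), of a] anchor_merge[OF xy(2), of b] by simp
  qed
qed

text \<open>
  Counting steps to \<open>H\<close> modulo \<open>2 * r\<close>, a point of residue \<open>0\<close> and a point of residue \<open>r\<close> on the same orbit
  are at least \<open>r\<close> steps apart, as long as \<open>H\<close> is not passed between them.
\<close>

lemma residues_zero_and_half_apart:
  fixes p q r :: nat
  assumes "p mod (2 * r) = 0" "q mod (2 * r) = r" "p < q + r" "q < p + r"
  shows False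
proof -
  obtain s where s: "p = 2 * r * s"
    using assms(1) by fastforce
  obtain t where t: "q = 2 * r * t + r"
    using assms(2) mult_div_mod_eq[of "2 * r" q] by metis
  consider "s \<le> t" | "Suc t \<le> s" by linarith
  then show False
  proof cases
    case 1
    then have "2 * r * s \<le> 2 * r * t" by simp
    with s t assms show False by linarith
  next
    case 2
    then have "2 * r * Suc t \<le> 2 * r * s" by (intro mult_le_mono2)
    with s t assms show False by simp
  qed
qed

lemma forward_independent_hitting_sets_imp_asdim_le_1:
  assumes indep: "\<And>r. r > 0 \<Longrightarrow> \<exists>H\<in>sets M. forward_independent r f H \<and> hitting_set (space M) f H"
  shows "Borel_asdim_le M G 1"
  unfolding Borel_asdim_le_def
proof (intro allI impI)
  fix r :: nat assume r: "r > 0"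
  obtain H where H [measurable]: "H \<in> sets M"
    and H_indep: "forward_independent (2 * r) f H" and H_hit: "hitting_set (space M) f H"
    using indep[of "2 * r"] r by auto
  define n where "n = first_hit H"
  have n_measurable [measurable]: "n \<in> M \<rightarrow>\<^sub>M count_space UNIV"
    unfolding n_def by measurable
  \<comment> \<open>\<open>m x\<close> is the number of steps to \<open>H\<close> right after the orbit of \<open>x\<close> has passed \<open>H\<close> for the first time.\<close>
  define m where "m x = n ((f ^^ Suc (n x)) x)" for x
  have hit: "\<exists>k. (f ^^ k) x \<in> H" if "x \<in> space M" for x
    using H_hit that unfolding hitting_set_def by blast
  have in_H: "(f ^^ n x) x \<in> H" if "x \<in> space M" for x
    using hit[OF that] first_hit_in unfolding n_def by blast
  have n_funpow: "n ((f ^^ i) x) = n x - i" if "x \<in> space M" "i \<le> n x" for x i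
    using first_hit_funpow hit that unfolding n_def by blast
  have n_funpow_after: "n ((f ^^ (Suc (n x) + i)) x) = m x - i" if "x \<in> space M" "i \<le> m x" for x i
  proof -
    have "(f ^^ (Suc (n x) + i)) x = (f ^^ i) ((f ^^ Suc (n x)) x)"
      by (metis add.commute comp_apply funpow_add)
    then show ?thesis
      using n_funpow[of "(f ^^ Suc (n x)) x" i] funpow_closed[of x "Suc (n x)"] that
      unfolding m_def by metis
  qed
  have m_ge: "2 * r \<le> m x" if x: "x \<in> space M" for x
  proof -
    have "(f ^^ n x) x \<in> H" "(f ^^ m x) ((f ^^ Suc (n x)) x) \<in> H"
      using in_H[OF x] in_H[OF funpow_closed[OF x, of "Suc (n x)"]] unfolding m_def .
    moreover have "(f ^^ m x) ((f ^^ Suc (n x)) x) = (f ^^ Suc (m x)) ((f ^^ n x) x)"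
      by (simp add: funpow_swap1)
    ultimately have "2 * r < Suc (m x)"
      using H_indep unfolding forward_independent_def by (metis zero_less_Suc)
    then show ?thesis by simp
  qed
  \<comment> \<open>A point \<open>h\<close> of \<open>H\<close> has residue \<open>0\<close>. The next point of residue \<open>r\<close> comes within \<open>r\<close> steps precisely
    when \<open>n (f h)\<close> has a residue in \<open>{r..<2 * r}\<close>; then \<open>h\<close> is dropped. This keeps the gaps in \<open>A0\<close>
    bounded: since \<open>n (f h) \<ge> 2 * r\<close>, the orbit meets a point with residue \<open>0\<close> and \<open>n > 0\<close> soon after \<open>h\<close>.
    The condition looks only forward along orbits; one in terms of the distance from the previous point of
    \<open>H\<close> would involve images under \<open>f\<close>, which need not be Borel.\<close>
  define A0 where "A0 = {x \<in> space M. n x mod (2 * r) = 0 \<and> (n x = 0 \<longrightarrow> n (f x) mod (2 * r) < r)}"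
  define A1 where "A1 = {x \<in> space M. n x mod (2 * r) = r}"
  have A0_hit: "\<exists>k\<le>4 * r. (f ^^ k) x \<in> A0" if x: "x \<in> space M" for x
  proof -
    have small: "v mod (2 * r) < 2 * r" for v
      using r by simp
    have down: "v - v mod (2 * r) > 0 \<and> (v - v mod (2 * r)) mod (2 * r) = 0" if "v \<ge> 2 * r" for v
      using small[of v] that minus_mod_eq_mult_div[of v "2 * r"]
      by (metis mod_mult_self1_is_0 order_less_le_trans zero_less_diff)
    consider (far) "2 * r \<le> n x"
      | (keep) "n x < 2 * r" "m x mod (2 * r) < r"
      | (drop) "n x < 2 * r" "m x mod (2 * r) \<ge> r"
      by linarith
    then show ?thesis
    proof cases
      case far
      let ?i = "n x mod (2 * r)"
      have "n ((f ^^ ?i) x) = n x - ?i"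
        using n_funpow[OF x] by simp
      then have "(f ^^ ?i) x \<in> A0"
        using down[OF far] funpow_closed[OF x] by (simp add: A0_def)
      moreover have "?i \<le> 4 * r"
        using small[of "n x"] by linarith
      ultimately show ?thesis by blast
    next
      case keep
      have "n ((f ^^ n x) x) = 0" "n (f ((f ^^ n x) x)) = m x"
        using n_funpow[OF x, of "n x"] by (auto simp: m_def)
      then have "(f ^^ n x) x \<in> A0"
        using keep funpow_closed[OF x] by (simp add: A0_def)
      with keep show ?thesis
        by (intro exI[of _ "n x"]) simp
    next
      case drop
      let ?i = "m x mod (2 * r)"
      have "n ((f ^^ (Suc (n x) + ?i)) x) = m x - ?i"
        using n_funpow_after[OF x] by simp
      then have "(f ^^ (Suc (n x) + ?i)) x \<in> A0"
        using down[OF m_ge[OF x]] funpow_closed[OF x, of "Suc (n x) + ?i"] unfolding A0_def by simp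
      moreover have "Suc (n x) + ?i \<le> 4 * r"
        using small[of "m x"] drop by linarith
      ultimately show ?thesis by blast
    qed
  qed
  have A1_hit: "\<exists>k\<le>4 * r. (f ^^ k) x \<in> A1" if x: "x \<in> space M" for x
  proof -
    have down: "\<exists>i<2 * r. i \<le> v \<and> (v - i) mod (2 * r) = r" if "r \<le> v" for v
    proof (intro exI conjI)
      let ?i = "(v - r) mod (2 * r)"
      show "?i < 2 * r"
        using r by simp
      have "?i \<le> v - r"
        by simp
      then show "?i \<le> v"
        by linarith
      have "v - ?i = r + (v - r - ?i)"
        using \<open>?i \<le> v - r\<close> that by linarith
      also have "\<dots> = r + 2 * r * ((v - r) div (2 * r))"
        by (simp only: minus_mod_eq_mult_div)
      finally show "(v - ?i) mod (2 * r) = r"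
        using r by simp
    qed
    show ?thesis
    proof (cases "r \<le> n x")
      case True
      then obtain i where "i < 2 * r" "i \<le> n x" "(n x - i) mod (2 * r) = r"
        using down by blast
      then show ?thesis
        using n_funpow[OF x, of i] funpow_closed[OF x] by (intro exI[of _ i]) (auto simp: A1_def)
    next
      case False
      obtain i where "i < 2 * r" "i \<le> m x" "(m x - i) mod (2 * r) = r"
        using down[of "m x"] m_ge[OF x] by fastforce
      then show ?thesis
        using n_funpow_after[OF x, of i] funpow_closed[OF x, of "Suc (n x) + i"] False
        by (intro exI[of _ "Suc (n x) + i"]) (auto simp: A1_def simp del: funpow.simps)
    qed
  qed
  have apart: False
    if x: "x \<in> space M" and i: "i < r" "(f ^^ i) x \<in> A0" and j: "j < r" "(f ^^ j) x \<in> A1" for x i j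
  proof -
    let ?p = "n ((f ^^ i) x)" and ?q = "n ((f ^^ j) x)"
    have p: "?p mod (2 * r) = 0" and q: "?q mod (2 * r) = r"
      using i j by (auto simp: A0_def A1_def)
    have far: False if "?p < ?q + r" "?q < ?p + r"
      by (rule residues_zero_and_half_apart[OF p q that])
    have after: "n ((f ^^ k) x) = m x - (k - Suc (n x))" if "n x < k" "k < r" for k
      using n_funpow_after[OF x, of "k - Suc (n x)"] m_ge[OF x] that by simp
    consider (below) "i \<le> n x" "j \<le> n x" | (crossed) "j \<le> n x" "n x < i"
      | (crossing) "i \<le> n x" "n x < j" | (above) "n x < i" "n x < j"
      by linarith
    then show False
    proof cases
      \<comment> \<open>The two points are on the same side of the first point of \<open>H\<close>, so their residues are comparable.\<close>
      case below
      then have "?p = n x - i" "?q = n x - j"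
        using n_funpow[OF x] by auto
      then show False
        using far i j below by linarith
    next
      case crossed
      then have "?q < r"
        using n_funpow[OF x, of j] i by linarith
      then show False
        using q by simp
    next
      \<comment> \<open>The point of \<open>A0\<close> is the first point of \<open>H\<close>, and it was kept in spite of the point of \<open>A1\<close> nearby.\<close>
      case crossing
      have n_i: "?p = n x - i"
        using n_funpow[OF x] crossing by blast
      then have "?p < r"
        using crossing j by linarith
      then have "?p = 0"
        using p by simp
      then have "i = n x" "m x mod (2 * r) < r"
        using n_i crossing i by (auto simp: A0_def m_def)
      define e where "e = j - Suc (n x)"
      have e: "e < r" "?q = m x - e" "e \<le> m x"
        using after[of j] crossing j m_ge[OF x] by (auto simp: e_def)
      have "m x = ?q + e"
        using e by linarith
      then have "m x mod (2 * r) = (r + e) mod (2 * r)"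
        using q by (metis mod_add_left_eq)
      also have "\<dots> = r + e"
        using e by simp
      finally show False
        using \<open>m x mod (2 * r) < r\<close> by simp
    next
      case above
      then have "?p = m x - (i - Suc (n x))" "?q = m x - (j - Suc (n x))"
        using after i j by auto
      then show False
        using far i j above m_ge[OF x] by linarith
    qed
  qed
  define V where "V A = {x \<in> space M. \<forall>k<r. (f ^^ k) x \<notin> A}" for A
  have A [measurable]: "A0 \<in> sets M" "A1 \<in> sets M"
    unfolding A0_def A1_def by measurable
  have V_measurable: "V A \<in> sets M" if [measurable]: "A \<in> sets M" for A
    unfolding V_def by measurable
  have bounded: "uniformly_bounded_equiv \<rho> (V A) (proximity_equiv \<rho> r (V A))" if "A = A0 \<or> A = A1" for A
    using bounded_below_syndetic_set[OF _ V_def] A0_hit A1_hit that by blast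
  have cover: "V A0 \<union> V A1 = space M"
    using apart unfolding V_def by blast
  define U where "U i = (if i = 0 then V A0 else V A1)" for i :: nat
  show "\<exists>U :: nat \<Rightarrow> 'a set. (\<forall>i\<le>1. U i \<in> sets M) \<and> (\<Union>i\<le>1. U i) = space M \<and>
      (\<forall>i\<le>1. uniformly_bounded_equiv \<rho> (U i) (proximity_equiv \<rho> r (U i)))"
  proof (intro exI[of _ U] conjI allI impI)
    show "(\<Union>i\<le>1. U i) = space M"
      using cover by (simp add: U_def atMost_Suc Un_commute)
    show "U i \<in> sets M" for i
      using V_measurable A by (simp add: U_def)
    show "uniformly_bounded_equiv \<rho> (U i) (proximity_equiv \<rho> r (U i))" for i
      using bounded by (simp add: U_def)
  qed
qed

end

section \<open>The equivalence\<close>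

lemma Borel_asdim_eq_1_iff:
  assumes "\<not> Borel_asdim_le M G 0"
  shows "Borel_asdim M G = 1 \<longleftrightarrow> Borel_asdim_le M G 1"
proof
  assume "Borel_asdim M G = 1"
  then show "Borel_asdim_le M G 1"
    unfolding Borel_asdim_def one_enat_def by (metis LeastI enat.distinct(1) enat.inject)
next
  assume le: "Borel_asdim_le M G 1"
  have "(LEAST d. Borel_asdim_le M G d) = 1"
    using le assms by (intro Least_equality) (auto simp: Suc_le_eq intro: gr0I)
  then show "Borel_asdim M G = 1"
    using le unfolding Borel_asdim_def one_enat_def by auto
qed

theorem theorem1p2:
  fixes M :: "'a measure" and f :: "'a \<Rightarrow> 'a"
  assumes "standard_Borel M"
    and "space M \<noteq> {}"
    and "f \<in> M \<rightarrow>\<^sub>M M"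
    and "acyclic_function_on (space M) f"
  shows "(Borel_asdim M (function_graph (space M) f) < \<infinity> \<longleftrightarrow>
            Borel_asdim M (function_graph (space M) f) = 1) \<and>
         (Borel_asdim M (function_graph (space M) f) = 1 \<longleftrightarrow>
            (\<forall>r::nat. r > 0 \<longrightarrow>
               (\<exists>H \<in> sets M. forward_independent r f H \<and> hitting_set (space M) f H)))"
proof -
  interpret acyclic_Borel_map M f
    using assms by unfold_locales
  have eq_1: "Borel_asdim M G = 1 \<longleftrightarrow> Borel_asdim_le M G 1"
    by (rule Borel_asdim_eq_1_iff[OF not_asdim_le_0[OF assms(2)]])
  have finite: "Borel_asdim M G < \<infinity> \<longleftrightarrow> (\<exists>d. Borel_asdim_le M G d)"
    by (simp add: Borel_asdim_def)
  show ?thesis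
    unfolding eq_1 finite
    using finite_asdim_imp_forward_independent_hitting_set
      forward_independent_hitting_sets_imp_asdim_le_1 by blast
qed

end
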